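(* In per-key MagnifierSketch, the expectation of the amortized time complexity to insert an arbitrary item $e=(k,v)$ is at most $O\!\left(\frac{s}{r}+d\right)$.
   Context: Fix a target quantile $w\in(0,1)$ and positive even integers $r,s$. A value field consists of a Candidate multiset $C$ (capacity $r$) and a Representative multiset $R$ (capacity $s$), initially empty. Basic insertion of $x$ (real or $\pm\infty$): add $x$ to $C$; if now $|C|=r$, compute the $(r/2)$-th and $(r/2+1)$-th smallest elements $v',v''$ of $C$, empty $C$, add $v',v''$ to $R$; if now $|R|>s$, find and remove one maximum and one minimum of $R$. Inserting a value $v$ into a value field: if $w>1/2$ draw $Z$ geometric on $\{1,2,\dots\}$ with success probability $1/(2w)$ and basic-insert $Z-1$ copies of $+\infty$ then $v$; if $w<1/2$ draw $Z$ geometric with success probability $1/(2-2w)$ and basic-insert $Z-1$ copies of $-\infty$ then $v$; if $w=1/2$ basic-insert $v$. Per-key MagnifierSketch processes a stream of key-value pairs and consists of two stages. Stage 1 is a Tower Sketch: a constant number of arrays of counters, each with its own hash function; inserting key $k$ increments (with saturation) the counter it maps to in each array, and querying $k$ returns the minimum of these counters. Stage 2 is a Value Sketch: $u$ buckets $B[1..u]$, a hash function $h$ from keys to buckets, each bucket with a counter $vote^-$ (initially $0$) and $d$ cells, each cell holding a key, a counter $vote^+$, and a value field; parameter $\lambda>0$. Value Sketch insertion of $(k,v)$: (1) if some cell of $B[h(k)]$ holds $k$, increment its $vote^+$ and insert $v$ into its value field; (2) else if $B[h(k)]$ has an empty cell, store $k$ there with $vote^+=1$ and insert $v$ into its value field;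 (3) else increment $B[h(k)].vote^-$, let $j$ be the cell of minimum $vote^+$, and if $B[h(k)].vote^-\ge\lambda\cdot B[h(k)][j].vote^+$, clear cell $j$, store $k$ with $vote^+=1$, insert $v$ into its fresh value field and reset $vote^-$ to $0$; otherwise do nothing. MagnifierSketch insertion of $(k,v)$ with threshold $T$: if the Tower Sketch query for $k$ is less than $T$, insert $k$ into the Tower Sketch and stop; otherwise insert $(k,v)$ into the Value Sketch. Time is measured in the word-RAM model, with expectation over the random draws of $Z$. *)

theory Defs
  imports "HOL-Probability.Probability" "HOL-Library.Monad_Syntax" "HOL-Library.Multiset"
begin

section \<open>Cost model\<close>

text \<open>
  A deterministic computation is a pair of its result and the number of word-RAM steps it takes.
  Only the primitives below consume steps. Lists stand for arrays with a stored fill count; they,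
  and the records containing them, are held by reference and used linearly, so a one-cell
  update, appending, deleting the last entry, reading the length and resetting the fill count are
  single steps. Everything that traverses an array is written as a loop which pays in every
  iteration. The expression under \<open>op\<close> is always a single word operation (comparison,
  arithmetic, evaluation of a hash function, field access) or a constant number of those.
\<close>

type_synonym 'a timed = "'a \<times> nat"

definition tret :: "'a \<Rightarrow> 'a timed" where
  "tret x = (x, 0)"

definition tbind :: "'a timed \<Rightarrow> ('a \<Rightarrow> 'b timed) \<Rightarrow> 'b timed" where
  "tbind m f = (fst (f (fst m)), snd m + snd (f (fst m)))"

adhoc_overloading Monad_Syntax.bind \<rightleftharpoons> tbind

lemma tbind_cong [fundef_cong]:
  assumes "m = m'" and "\<And>x. x = fst m' \<Longrightarrow> f x = f' x"
  shows "tbind m f = tbind m' f'"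
  using assms by (simp add: tbind_def)

definition op :: "'a \<Rightarrow> 'a timed" where
  "op x = (x, 1)"

definition rd :: "'a list \<Rightarrow> nat \<Rightarrow> 'a timed" where
  "rd xs i = (xs ! i, 1)"

definition wr :: "'a list \<Rightarrow> nat \<Rightarrow> 'a \<Rightarrow> 'a list timed" where
  "wr xs i x = (xs[i := x], 1)"

definition len :: "'a list \<Rightarrow> nat timed" where
  "len xs = (length xs, 1)"

definition push :: "'a list \<Rightarrow> 'a \<Rightarrow> 'a list timed" where
  "push xs x = (xs @ [x], 1)"

definition pop :: "'a list \<Rightarrow> 'a list timed" where
  "pop xs = (butlast xs, 1)"

definition clear :: "'a list \<Rightarrow> 'a list timed" where
  "clear xs = ([], 1)"

text \<open>Randomised computations: joint law of result and number of steps.\<close>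

datatype 'a comp = Comp (law: "('a \<times> nat) pmf")

definition cbind :: "'a comp \<Rightarrow> ('a \<Rightarrow> 'b comp) \<Rightarrow> 'b comp" where
  "cbind m f = Comp (bind_pmf (law m) (\<lambda>(x, t). map_pmf (\<lambda>(y, t'). (y, t + t')) (law (f x))))"

adhoc_overloading Monad_Syntax.bind \<rightleftharpoons> cbind

definition lift :: "'a timed \<Rightarrow> 'a comp" where
  "lift m = Comp (return_pmf m)"

text \<open>
  The library's \<^const>\<open>geometric_pmf\<close> counts failures and thus lives on \<open>{0, 1, \<dots>}\<close>. A draw of
  \<open>Z\<close> is paid with \<open>Z\<close> steps, one for each coin flip.
\<close>

definition draw_geometric :: "real \<Rightarrow> nat comp" where
  "draw_geometric p = Comp (map_pmf (\<lambda>n. (Suc n, Suc n)) (geometric_pmf p))"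


section \<open>Array subroutines\<close>

fun scan_first_from :: "('a \<Rightarrow> bool) \<Rightarrow> 'a list \<Rightarrow> nat \<Rightarrow> nat option timed" where
  "scan_first_from P [] i = op None"
| "scan_first_from P (x # xs) i = do {
     b \<leftarrow> op (P x);
     if b then tret (Some i) else scan_first_from P xs (i + 1)
   }"

definition scan_first :: "('a \<Rightarrow> bool) \<Rightarrow> 'a list \<Rightarrow> nat option timed" where
  "scan_first P xs = scan_first_from P xs 0"

fun scan_best_from :: "('a \<Rightarrow> 'a \<Rightarrow> bool) \<Rightarrow> 'a \<Rightarrow> nat \<Rightarrow> 'a list \<Rightarrow> nat \<Rightarrow> nat timed" where
  "scan_best_from better y j [] i = op j"
| "scan_best_from better y j (x # xs) i = do {
     b \<leftarrow> op (better x y);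
     if b then scan_best_from better x i xs (i + 1) else scan_best_from better y j xs (i + 1)
   }"

text \<open>The first index whose entry is not beaten by any other entry.\<close>

definition scan_best :: "('a \<Rightarrow> 'a \<Rightarrow> bool) \<Rightarrow> 'a list \<Rightarrow> nat timed" where
  "scan_best better xs = do {
     x \<leftarrow> rd xs 0;
     scan_best_from better x 0 (tl xs) 1
   }"

text \<open>Order is irrelevant in the arrays this is used for: the last entry fills the gap.\<close>

definition remove_at :: "'a list \<Rightarrow> nat \<Rightarrow> 'a list timed" where
  "remove_at xs i = do {
     n \<leftarrow> len xs;
     y \<leftarrow> rd xs (n - 1);
     ys \<leftarrow> wr xs i y;
     pop ys
   }"


subsection \<open>Deterministic selection (median of medians)\<close>

fun sort_insert :: "ereal \<Rightarrow> ereal list \<Rightarrow> ereal list timed" where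
  "sort_insert x [] = op [x]"
| "sort_insert x (y # ys) = do {
     a \<leftarrow> op (min x y);
     b \<leftarrow> op (max x y);
     zs \<leftarrow> sort_insert b ys;
     op (a # zs)
   }"

fun insertion_sort :: "ereal list \<Rightarrow> ereal list timed" where
  "insertion_sort [] = op []"
| "insertion_sort (x # xs) = do {
     ys \<leftarrow> insertion_sort xs;
     sort_insert x ys
   }"

text \<open>Medians of the complete groups of five; up to four trailing elements are ignored.\<close>

fun group_medians :: "ereal list \<Rightarrow> ereal list \<Rightarrow> ereal list timed" where
  "group_medians (a # b # c # d # e # xs) ms = do {
     ys \<leftarrow> insertion_sort [a, b, c, d, e];
     m \<leftarrow> rd ys 2;
     ms' \<leftarrow> push ms m;
     group_medians xs ms'
   }"
| "group_medians xs ms = op ms"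

text \<open>Splits into the entries below the pivot, the number of copies of it, and those above it.\<close>

fun partition3 ::
  "ereal \<Rightarrow> ereal list \<Rightarrow> ereal list \<Rightarrow> nat \<Rightarrow> ereal list \<Rightarrow> (ereal list \<times> nat \<times> ereal list) timed"
where
  "partition3 p [] ls n gs = op (ls, n, gs)"
| "partition3 p (x # xs) ls n gs = do {
     lt \<leftarrow> op (x < p);
     if lt then do {
       ls' \<leftarrow> push ls x;
       partition3 p xs ls' n gs
     } else do {
       eq \<leftarrow> op (x = p);
       if eq then do {
         n' \<leftarrow> op (n + 1);
         partition3 p xs ls n' gs
       } else do {
         gs' \<leftarrow> push gs x;
         partition3 p xs ls n gs'
       }
     }
   }"

text \<open>\<open>select k xs\<close> finds the \<open>(k + 1)\<close>-th smallest entry of \<open>xs\<close>.\<close>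

function select :: "nat \<Rightarrow> ereal list \<Rightarrow> ereal timed" where
  "select k xs = do {
     n \<leftarrow> len xs;
     small \<leftarrow> op (n < 32);
     if small then do {
       ys \<leftarrow> insertion_sort xs;
       rd ys k
     } else do {
       ms \<leftarrow> group_medians xs [];
       l \<leftarrow> len ms;
       q \<leftarrow> op ((l - 1) div 2);
       p \<leftarrow> select q ms;
       part \<leftarrow> partition3 p xs [] 0 [];
       nl \<leftarrow> len (fst part);
       below \<leftarrow> op (k < nl);
       if below then select k (fst part)
       else do {
         hit \<leftarrow> op (k < nl + fst (snd part));
         if hit then tret p
         else do {
           k' \<leftarrow> op (k - nl - fst (snd part));
           select k' (snd (snd part))
         }
       }
     }
   }"
  by pat_completeness auto


lemma fst_tbind [simp]: "fst (tbind m f) = fst (f (fst m))"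
  by (simp add: tbind_def)

lemma fst_tret [simp]: "fst (tret x) = x"
  by (simp add: tret_def)

lemma fst_op [simp]: "fst (op x) = x"
  by (simp add: op_def)

lemma fst_array_simps [simp]:
  "fst (rd xs i) = xs ! i" "fst (wr xs i x) = xs[i := x]" "fst (len xs) = length xs"
  "fst (push xs x) = xs @ [x]" "fst (pop xs) = butlast xs" "fst (clear xs) = []"
  by (simp_all add: rd_def wr_def len_def push_def pop_def clear_def)

lemma sort_insert_correct: "sorted ys \<Longrightarrow> fst (sort_insert x ys) = insort x ys"
proof (induction ys arbitrary: x)
  case (Cons y ys)
  show ?case
  proof (cases "x \<le> y")
    case True
    have "insort y ys = y # ys"
      using Cons.prems by (cases ys) auto
    then show ?thesis
      using True Cons by (simp add: min_def max_def)
  next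
    case False
    then show ?thesis
      using Cons by (simp add: min_def max_def)
  qed
qed simp

lemma insertion_sort_correct: "fst (insertion_sort xs) = sort xs"
  by (induction xs) (simp_all add: sort_insert_correct)

lemma insertion_sort_nth: "i < length xs \<Longrightarrow> fst (insertion_sort xs) ! i \<in> set xs"
  by (metis insertion_sort_correct length_sort nth_mem set_sort)

lemma group_medians_set: "set (fst (group_medians xs ms)) \<subseteq> set xs \<union> set ms"
proof (induction xs ms rule: group_medians.induct)
  case (1 a b c d e xs ms)
  have "fst (insertion_sort [a, b, c, d, e]) ! 2 \<in> {a, b, c, d, e}"
    using insertion_sort_nth[of 2 "[a, b, c, d, e]"] by (simp del: insertion_sort.simps)
  then show ?case
    using "1.IH"[OF refl refl refl] by (auto simp del: insertion_sort.simps)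
qed auto

lemma group_medians_length:
  "length (fst (group_medians xs ms)) = length ms + length xs div 5"
proof (induction xs ms rule: group_medians.induct)
  case (1 a b c d e xs ms)
  then show ?case
    by (simp del: insertion_sort.simps)
qed auto

lemma partition3_correct:
  "fst (partition3 p xs ls n gs) =
     (ls @ filter (\<lambda>x. x < p) xs, n + length (filter (\<lambda>x. x = p) xs), gs @ filter (\<lambda>x. p < x) xs)"
  by (induction xs arbitrary: ls n gs) auto

lemma sort_partition3:
  fixes xs :: "'a::linorder list"
  shows "sort xs = sort (filter (\<lambda>x. x < p) xs) @ filter (\<lambda>x. x = p) xs
    @ sort (filter (\<lambda>x. p < x) xs)"
proof (rule properties_for_sort)
  show "mset (sort (filter (\<lambda>x. x < p) xs) @ filter (\<lambda>x. x = p) xs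
    @ sort (filter (\<lambda>x. p < x) xs)) = mset xs"
    by (induction xs) auto
  have "sorted (filter (\<lambda>x. x = p) xs)"
    by (induction xs) auto
  then show "sorted (sort (filter (\<lambda>x. x < p) xs) @ filter (\<lambda>x. x = p) xs
    @ sort (filter (\<lambda>x. p < x) xs))"
    by (auto simp: sorted_append)
qed

lemma select_correct_aux:
  assumes "select_dom (k, xs)" and "k < length xs"
  shows "fst (select k xs) = sort xs ! k"
  using assms
proof (induction rule: select.pinduct)
  case (1 k xs)
  show ?case
  proof (cases "length xs < 32")
    case True
    then show ?thesis
      by (simp add: select.psimps[OF "1.hyps"] insertion_sort_correct)
  next
    case False
    define ms where "ms = fst (group_medians xs [])"
    define p where "p = fst (select ((length ms - 1) div 2) ms)"
    define ls es gs where "ls = filter (\<lambda>x. x < p) xs" and "es = filter (\<lambda>x. x = p) xs"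
      and "gs = filter (\<lambda>x. p < x) xs"
    have part: "fst (partition3 p xs [] 0 []) = (ls, length es, gs)"
      by (simp add: partition3_correct ls_def es_def gs_def)
    have srt: "sort xs = sort ls @ es @ sort gs"
      unfolding ls_def es_def gs_def by (rule sort_partition3)
    have lens: "length xs = length ls + (length es + length gs)"
      using arg_cong[OF srt, of length] by simp
    have sel: "fst (select k xs) = (if k < length ls then fst (select k ls)
        else if k < length ls + length es then p
        else fst (select (k - length ls - length es) gs))"
      using False part
      by (subst select.psimps[OF "1.hyps"]) (simp add: p_def ms_def)
    have big: "\<not> fst (op (fst (len xs) < 32))"
      using False by simp
    have IH1: "fst (select k ls) = sort ls ! k" if "k < length ls"
      using "1.IH"(2)[OF refl refl big refl refl refl refl refl refl refl] that part
      by (simp add: ms_def[symmetric] p_def[symmetric] del: One_nat_def)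
    have IH2: "fst (select (k - length ls - length es) gs) = sort gs ! (k - length ls - length es)"
      if "\<not> k < length ls + length es" "k - length ls - length es < length gs"
      using "1.IH"(3)[OF refl refl big refl refl refl refl refl refl refl _ refl _ refl] that part
      by (simp add: ms_def[symmetric] p_def[symmetric] del: One_nat_def)
    show ?thesis
    proof -
      consider "k < length ls" | "length ls \<le> k" "k < length ls + length es"
        | "length ls + length es \<le> k"
        by linarith
      then show ?thesis
      proof cases
        case 1
        then show ?thesis
          using sel srt IH1 by (simp add: nth_append)
      next
        case 2
        then have "es ! (k - length ls) \<in> set es"
          by (intro nth_mem) linarith
        then have "es ! (k - length ls) = p"
          by (simp add: es_def)
        moreover have "k - length ls < length es"
          using 2 by linarith
        ultimately show ?thesis
          using sel srt 2 by (simp add: nth_append)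
      next
        case 3
        then have "k - length ls - length es < length gs"
          using \<open>k < length xs\<close> lens by linarith
        then show ?thesis
          using sel srt IH2 3 by (auto simp: nth_append)
      qed
    qed
  qed
qed

lemma select_pivot:
  assumes "select_dom (q, ms)" and "\<not> length xs < 32"
    and ms: "ms = fst (group_medians xs [])" and q: "q = (length ms - 1) div 2"
  shows "fst (select q ms) \<in> set xs"
proof -
  have "length ms = length xs div 5"
    by (simp add: ms group_medians_length)
  then have "q < length ms"
    using assms(2) q by linarith
  then have "fst (select q ms) = sort ms ! q"
    by (intro select_correct_aux assms(1))
  then have "fst (select q ms) \<in> set ms"
    using \<open>q < length ms\<close> by (metis length_sort nth_mem set_sort)
  then show ?thesis
    using group_medians_set[of xs "[]"] by (auto simp: ms)
qed

lemma select_termination: "All select_dom"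
proof (relation "Wellfounded.measure (\<lambda>(k, xs). length xs)", goal_cases)
  case (2 k xs n small ms l q)
  then have "length ms = length xs div 5" "\<not> length xs < 32"
    by (simp_all add: group_medians_length)
  then show ?case
    by simp
next
  case (3 k xs n small ms l q p part nl below)
  have "\<not> length xs < 32" "q = (length ms - 1) div 2"
    using 3(1-3,5,6) by simp_all
  then have "p \<in> set xs"
    using select_pivot[OF 3(12) _ 3(4)] 3(7) by simp
  moreover have "fst part = filter (\<lambda>x. x < p) xs"
    using 3(8) by (simp add: partition3_correct)
  ultimately have "length (fst part) < length xs"
    using length_filter_less[of p xs "\<lambda>x. x < p"] by simp
  then show ?case
    by simp
next
  case (4 k xs n small ms l q p part nl below hit k')
  have "\<not> length xs < 32" "q = (length ms - 1) div 2"
    using 4(1-3,5,6) by simp_all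
  then have "p \<in> set xs"
    using select_pivot[OF 4(15) _ 4(4)] 4(7) by simp
  moreover have "snd (snd part) = filter (\<lambda>x. p < x) xs"
    using 4(8) by (simp add: partition3_correct)
  ultimately have "length (snd (snd part)) < length xs"
    using length_filter_less[of p xs "\<lambda>x. p < x"] by simp
  then show ?case
    by simp
qed simp

termination select
  by (rule select_termination)

declare select.simps [simp del]

lemma select_correct: "k < length xs \<Longrightarrow> fst (select k xs) = sort xs ! k"
  by (rule select_correct_aux) (use select_termination in auto)


lemma scan_best_from_correct:
  assumes asym: "\<And>a b. better a b \<Longrightarrow> \<not> better b a"
    and negtrans: "\<And>a b c. \<not> better a b \<Longrightarrow> \<not> better b c \<Longrightarrow> \<not> better a c"
    and "j < i" "i \<le> length zs" "xs = drop i zs" "y = zs ! j" "\<forall>l<i. \<not> better (zs ! l) y"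
  shows "fst (scan_best_from better y j xs i) < length zs \<and>
    (\<forall>l<length zs. \<not> better (zs ! l) (zs ! fst (scan_best_from better y j xs i)))"
  using assms(3-)
proof (induction xs arbitrary: y j i)
  case (Cons x xs)
  then have i: "i < length zs"
    by (metis drop_all linorder_not_less list.distinct(1))
  have x: "x = zs ! i" and xs: "xs = drop (Suc i) zs"
    using Cons.prems(3) Cons_nth_drop_Suc[OF i] by (metis list.inject)+
  show ?case
  proof (cases "better x y")
    case True
    have "\<not> better (zs ! l) x" if "l < Suc i" for l
      using that Cons.prems(5) asym True negtrans x by (metis less_SucE)
    then show ?thesis
      using Cons.IH[of i "Suc i" x] True i x xs by auto
  next
    case False
    then have "\<not> better (zs ! l) y" if "l < Suc i" for l
      using that Cons.prems(5) x by (metis less_SucE)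
    then show ?thesis
      using Cons.IH[of j "Suc i" y] False i xs Cons.prems(1,4) by auto
  qed
qed auto

lemma scan_best_correct:
  assumes "\<And>a b. better a b \<Longrightarrow> \<not> better b a"
    and "\<And>a b c. \<not> better a b \<Longrightarrow> \<not> better b c \<Longrightarrow> \<not> better a c"
    and "xs \<noteq> []"
  shows "fst (scan_best better xs) < length xs"
    and "x \<in> set xs \<Longrightarrow> \<not> better x (xs ! fst (scan_best better xs))"
proof -
  have "fst (scan_best_from better (xs ! 0) 0 (tl xs) 1) < length xs \<and>
    (\<forall>l<length xs. \<not> better (xs ! l) (xs ! fst (scan_best_from better (xs ! 0) 0 (tl xs) 1)))"
  proof (rule scan_best_from_correct[OF assms(1,2)])
    show "1 \<le> length xs"
      using assms(3) by (simp add: Suc_le_eq)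
    show "\<forall>l<1. \<not> better (xs ! l) (xs ! 0)"
      using assms(1) by (metis less_one)
  qed (simp_all add: drop_Suc)
  then show "fst (scan_best better xs) < length xs"
    and "x \<in> set xs \<Longrightarrow> \<not> better x (xs ! fst (scan_best better xs))"
    by (auto simp: scan_best_def in_set_conv_nth)
qed

lemma scan_best_max:
  fixes xs :: "ereal list"
  assumes "xs \<noteq> []"
  shows "fst (scan_best (\<lambda>a b. b < a) xs) < length xs"
    and "xs ! fst (scan_best (\<lambda>a b. b < a) xs) = Max (set xs)"
proof -
  note * = scan_best_correct[of "\<lambda>a b. b < a" xs, OF _ _ assms]
  show 1: "fst (scan_best (\<lambda>a b. b < a) xs) < length xs"
    by (rule *) auto
  show "xs ! fst (scan_best (\<lambda>a b. b < a) xs) = Max (set xs)"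
    using 1 *(2) by (intro Max_eqI[symmetric]) (auto simp: not_less)
qed

lemma scan_best_min:
  fixes xs :: "ereal list"
  assumes "xs \<noteq> []"
  shows "fst (scan_best (\<lambda>a b. a < b) xs) < length xs"
    and "xs ! fst (scan_best (\<lambda>a b. a < b) xs) = Min (set xs)"
proof -
  note * = scan_best_correct[of "\<lambda>a b. a < b" xs, OF _ _ assms]
  show 1: "fst (scan_best (\<lambda>a b. a < b) xs) < length xs"
    by (rule *) auto
  show "xs ! fst (scan_best (\<lambda>a b. a < b) xs) = Min (set xs)"
    using 1 *(2) by (intro Min_eqI[symmetric]) (auto simp: not_less)
qed

lemma remove_at_correct:
  assumes "i < length xs"
  shows "mset (fst (remove_at xs i)) = mset xs - {#xs ! i#}"
proof -
  obtain ys y where xs: "xs = ys @ [y]"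
    using assms by (metis append_butlast_last_id length_0_conv less_nat_zero_code)
  show ?thesis
  proof (cases "i < length ys")
    case True
    then have "ys ! i \<in># mset ys"
      by simp
    then show ?thesis
      using True
      by (simp add: remove_at_def xs nth_append list_update_append mset_update
          multi_union_self_other_eq diff_union_swap2 del: nth_mem_mset)
  next
    case False
    then have "i = length ys"
      using assms xs by simp
    then show ?thesis
      by (simp add: remove_at_def xs)
  qed
qed


section \<open>The sketch\<close>

record 'k sketch_params =
  quantile :: real
  cand_cap :: nat
  rep_cap :: nat
  tower_arrays :: nat
  tower_width :: "nat \<Rightarrow> nat"
  tower_max :: "nat \<Rightarrow> nat"
  tower_hash :: "nat \<Rightarrow> 'k \<Rightarrow> nat"
  threshold :: nat
  num_buckets :: nat
  num_cells :: nat
  bucket_hash :: "'k \<Rightarrow> nat"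
  evict_factor :: real

text \<open>\<open>tower_max P i\<close> is the value at which the counters of the \<open>i\<close>-th tower array saturate.\<close>

definition valid_params :: "'k sketch_params \<Rightarrow> bool" where
  "valid_params P \<longleftrightarrow>
     0 < quantile P \<and> quantile P < 1 \<and>
     0 < cand_cap P \<and> even (cand_cap P) \<and> 0 < rep_cap P \<and> even (rep_cap P) \<and>
     0 < tower_arrays P \<and> (\<forall>i<tower_arrays P. \<forall>k. tower_hash P i k < tower_width P i) \<and>
     0 < num_cells P \<and> (\<forall>k. bucket_hash P k < num_buckets P) \<and>
     0 < evict_factor P"


subsection \<open>Value fields\<close>

datatype vfield = VField (cand: "ereal list") (rep: "ereal list")

definition basic_insert :: "nat \<Rightarrow> nat \<Rightarrow> ereal \<Rightarrow> vfield \<Rightarrow> vfield timed" where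
  "basic_insert r s x F = do {
     C \<leftarrow> push (cand F) x;
     n \<leftarrow> len C;
     full \<leftarrow> op (n = r);
     if full then do {
       h \<leftarrow> op (r div 2);
       v' \<leftarrow> select (h - 1) C;
       v'' \<leftarrow> select h C;
       C' \<leftarrow> clear C;
       R \<leftarrow> push (rep F) v';
       R \<leftarrow> push R v'';
       l \<leftarrow> len R;
       over \<leftarrow> op (s < l);
       if over then do {
         i \<leftarrow> scan_best (\<lambda>a b. b < a) R;
         R \<leftarrow> remove_at R i;
         j \<leftarrow> scan_best (\<lambda>a b. a < b) R;
         R \<leftarrow> remove_at R j;
         op (VField C' R)
       } else op (VField C' R)
     } else op (VField C (rep F))
   }"

text \<open>The instrumented code implements the multiset description of basic insertion.\<close>

definition basic_insert_spec ::
  "nat \<Rightarrow> nat \<Rightarrow> ereal \<Rightarrow> ereal multiset \<Rightarrow> ereal multiset \<Rightarrow> ereal multiset \<times> ereal multiset"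
where
  "basic_insert_spec r s x C R =
     (let C' = add_mset x C; ys = sorted_list_of_multiset C';
          R' = R + {#ys ! (r div 2 - 1), ys ! (r div 2)#};
          R'' = R' - {#Max (set_mset R')#}
      in if size C' \<noteq> r then (C', R)
         else ({#}, if size R' > s then R'' - {#Min (set_mset R'')#} else R'))"

lemma basic_insert_correct:
  fixes F :: vfield and r s :: nat and x :: ereal
  assumes "2 \<le> r"
  defines "F' \<equiv> fst (basic_insert r s x F)"
  shows "(mset (cand F'), mset (rep F')) = basic_insert_spec r s x (mset (cand F)) (mset (rep F))"
proof (cases "Suc (length (cand F)) = r")
  case False
  then show ?thesis
    by (simp add: F'_def basic_insert_def basic_insert_spec_def Let_def)
next
  case True
  let ?C = "cand F @ [x]"
  have sorted: "sorted_list_of_multiset (add_mset x (mset (cand F))) = sort ?C"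
    using sorted_list_of_multiset_mset[of ?C] by simp
  have sel: "fst (select (r div 2 - 1) ?C) = sort ?C ! (r div 2 - 1)"
    "fst (select (r div 2) ?C) = sort ?C ! (r div 2)"
    using True assms(1) by (auto intro!: select_correct)
  define R where "R = rep F @ [sort ?C ! (r div 2 - 1), sort ?C ! (r div 2)]"
  define R1 where "R1 = fst (remove_at R (fst (scan_best (\<lambda>a b. b < a) R)))"
  define R2 where "R2 = fst (remove_at R1 (fst (scan_best (\<lambda>a b. a < b) R1)))"
  have "R \<noteq> []"
    by (simp add: R_def)
  then have R1: "mset R1 = mset R - {#Max (set R)#}"
    unfolding R1_def
    by (simp only: remove_at_correct[OF scan_best_max(1)] scan_best_max(2) not_False_eq_True
        \<open>R \<noteq> []\<close>)
  have "size (mset R) \<ge> 2"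
    by (simp add: R_def)
  moreover have "Max (set R) \<in># mset R"
    using Max_in[of "set R"] by (simp add: R_def del: Max_insert)
  ultimately have "size (mset R1) \<noteq> 0"
    unfolding R1 by (simp add: size_Diff_singleton)
  then have "R1 \<noteq> []"
    by auto
  then have R2: "mset R2 = mset R1 - {#Min (set R1)#}"
    unfolding R2_def
    by (simp only: remove_at_correct[OF scan_best_min(1)] scan_best_min(2) not_False_eq_True)
  have F': "F' = VField [] (if s < length R then R2 else R)"
    using True sel by (simp add: F'_def basic_insert_def R_def R1_def R2_def)
  have mR: "mset (rep F) + {#sort ?C ! (r div 2 - 1), sort ?C ! (r div 2)#} = mset R"
    by (simp add: R_def)
  have "size (add_mset x (mset (cand F))) = r"
    using True by simp
  then have "basic_insert_spec r s x (mset (cand F)) (mset (rep F)) =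
      ({#}, if s < length R then mset R2 else mset R)"
    unfolding basic_insert_spec_def Let_def sorted mR
    by (simp only: not_True_eq_False if_False set_mset_mset R1[symmetric] R2[symmetric] size_mset simp_thms)
  then show ?thesis
    unfolding F' by simp
qed

fun insert_copies :: "nat \<Rightarrow> nat \<Rightarrow> nat \<Rightarrow> ereal \<Rightarrow> vfield \<Rightarrow> vfield timed" where
  "insert_copies r s 0 x F = op F"
| "insert_copies r s (Suc n) x F = do {
     F' \<leftarrow> basic_insert r s x F;
     insert_copies r s n x F'
   }"

definition field_insert :: "'k sketch_params \<Rightarrow> real \<Rightarrow> vfield \<Rightarrow> vfield comp" where
  "field_insert P v F =
     (let w = quantile P; r = cand_cap P; s = rep_cap P in
      if w > 1/2 then do {
        Z \<leftarrow> draw_geometric (1 / (2 * w));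
        F' \<leftarrow> lift (insert_copies r s (Z - 1) \<infinity> F);
        lift (basic_insert r s (ereal v) F')
      }
      else if w < 1/2 then do {
        Z \<leftarrow> draw_geometric (1 / (2 - 2 * w));
        F' \<leftarrow> lift (insert_copies r s (Z - 1) (-\<infinity>) F);
        lift (basic_insert r s (ereal v) F')
      }
      else lift (basic_insert r s (ereal v) F))"


subsection \<open>Tower Sketch\<close>

definition tower_read :: "'k sketch_params \<Rightarrow> nat list list \<Rightarrow> 'k \<Rightarrow> nat \<Rightarrow> nat timed" where
  "tower_read P A k i = do {
     j \<leftarrow> op (tower_hash P i k);
     row \<leftarrow> rd A i;
     rd row j
   }"

fun tower_min :: "'k sketch_params \<Rightarrow> nat list list \<Rightarrow> 'k \<Rightarrow> nat \<Rightarrow> nat timed" where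
  "tower_min P A k 0 = tower_read P A k 0"
| "tower_min P A k (Suc i) = do {
     a \<leftarrow> tower_min P A k i;
     b \<leftarrow> tower_read P A k (Suc i);
     op (min a b)
   }"

definition tower_query :: "'k sketch_params \<Rightarrow> nat list list \<Rightarrow> 'k \<Rightarrow> nat timed" where
  "tower_query P A k = tower_min P A k (tower_arrays P - 1)"

fun tower_increment :: "'k sketch_params \<Rightarrow> 'k \<Rightarrow> nat \<Rightarrow> nat list list \<Rightarrow> nat list list timed" where
  "tower_increment P k 0 A = op A"
| "tower_increment P k (Suc i) A = do {
     A' \<leftarrow> tower_increment P k i A;
     j \<leftarrow> op (tower_hash P i k);
     row \<leftarrow> rd A' i;
     c \<leftarrow> rd row j;
     c' \<leftarrow> op (min (c + 1) (tower_max P i));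
     row' \<leftarrow> wr row j c';
     wr A' i row'
   }"

definition tower_insert :: "'k sketch_params \<Rightarrow> nat list list \<Rightarrow> 'k \<Rightarrow> nat list list timed" where
  "tower_insert P A k = tower_increment P k (tower_arrays P) A"


subsection \<open>Value Sketch\<close>

datatype 'k vcell = VCell (cell_key: 'k) (vote_plus: nat) (cell_field: vfield)

text \<open>An empty cell is \<^const>\<open>None\<close>.\<close>

datatype 'k bucket = Bucket (vote_minus: nat) (cells: "'k vcell option list")

definition holds :: "'k \<Rightarrow> 'k vcell option \<Rightarrow> bool" where
  "holds k c \<longleftrightarrow> (case c of None \<Rightarrow> False | Some c' \<Rightarrow> cell_key c' = k)"

definition fewer_votes :: "'k vcell option \<Rightarrow> 'k vcell option \<Rightarrow> bool" where
  "fewer_votes c c' \<longleftrightarrow> vote_plus (the c) < vote_plus (the c')"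

definition clear_field :: "vfield \<Rightarrow> vfield timed" where
  "clear_field F = do {
     C \<leftarrow> clear (cand F);
     R \<leftarrow> clear (rep F);
     op (VField C R)
   }"

definition value_sketch_insert ::
  "'k sketch_params \<Rightarrow> 'k \<Rightarrow> real \<Rightarrow> 'k bucket list \<Rightarrow> 'k bucket list comp"
where
  "value_sketch_insert P k v Bs = do {
     i \<leftarrow> lift (op (bucket_hash P k));
     B \<leftarrow> lift (rd Bs i);
     found \<leftarrow> lift (scan_first (holds k) (cells B));
     case found of
       Some j \<Rightarrow> do {
         c \<leftarrow> lift (rd (cells B) j);
         vp \<leftarrow> lift (op (vote_plus (the c) + 1));
         F \<leftarrow> field_insert P v (cell_field (the c));
         cs \<leftarrow> lift (wr (cells B) j (Some (VCell k vp F)));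
         lift (wr Bs i (Bucket (vote_minus B) cs))
       }
     | None \<Rightarrow> do {
         free \<leftarrow> lift (scan_first Option.is_none (cells B));
         case free of
           Some j \<Rightarrow> do {
             F \<leftarrow> field_insert P v (VField [] []);
             cs \<leftarrow> lift (wr (cells B) j (Some (VCell k 1 F)));
             lift (wr Bs i (Bucket (vote_minus B) cs))
           }
         | None \<Rightarrow> do {
             vm \<leftarrow> lift (op (vote_minus B + 1));
             j \<leftarrow> lift (scan_best fewer_votes (cells B));
             c \<leftarrow> lift (rd (cells B) j);
             evict \<leftarrow> lift (op (real vm \<ge> evict_factor P * real (vote_plus (the c))));
             if evict then do {
               F0 \<leftarrow> lift (clear_field (cell_field (the c)));
               F \<leftarrow> field_insert P v F0;
               cs \<leftarrow> lift (wr (cells B) j (Some (VCell k 1 F)));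
               lift (wr Bs i (Bucket 0 cs))
             } else lift (wr Bs i (Bucket vm (cells B)))
           }
       }
   }"


subsection \<open>Per-key MagnifierSketch\<close>

datatype 'k sketch = Sketch (tower: "nat list list") (buckets: "'k bucket list")

definition initial_sketch :: "'k sketch_params \<Rightarrow> 'k sketch" where
  "initial_sketch P = Sketch
     (map (\<lambda>i. replicate (tower_width P i) 0) [0..<tower_arrays P])
     (replicate (num_buckets P) (Bucket 0 (replicate (num_cells P) None)))"

definition sketch_insert ::
  "'k sketch_params \<Rightarrow> 'k \<times> real \<Rightarrow> 'k sketch \<Rightarrow> 'k sketch comp"
where
  "sketch_insert P e S = do {
     q \<leftarrow> lift (tower_query P (tower S) (fst e));
     b \<leftarrow> lift (op (q < threshold P));
     if b then do {
       A \<leftarrow> lift (tower_insert P (tower S) (fst e));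
       lift (op (Sketch A (buckets S)))
     } else do {
       Bs \<leftarrow> value_sketch_insert P (fst e) (snd e) (buckets S);
       lift (op (Sketch (tower S) Bs))
     }
   }"

fun process_stream ::
  "'k sketch_params \<Rightarrow> ('k \<times> real) list \<Rightarrow> 'k sketch \<Rightarrow> 'k sketch comp"
where
  "process_stream P [] S = lift (tret S)"
| "process_stream P (e # es) S = do {
     S' \<leftarrow> sketch_insert P e S;
     process_stream P es S'
   }"

text \<open>
  Amortized time per item of a run on a non-empty stream, in expectation over the draws of \<open>Z\<close>.
  The nonnegative integral is used so that an infinite expectation would not be hidden.
\<close>

definition expected_amortized_time :: "'k sketch_params \<Rightarrow> ('k \<times> real) list \<Rightarrow> ennreal" where
  "expected_amortized_time P es =
     (\<integral>\<^sup>+ (S, t). ennreal (real t / real (length es))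
        \<partial>measure_pmf (law (process_stream P es (initial_sketch P))))"

end

theory Submission
  imports Defs
begin

text \<open>
  Median of medians selects in linear time, so a basic insertion that flushes the candidates costs
  \<open>O(r + s)\<close>, and any other basic insertion costs \<open>O(1)\<close>. Hence the potential
  \<open>O(1 + s / r)\<close> per stored candidate, summed over all cells, pays for the flushes; evicting a cell
  can only release potential. The success probability of \<open>Z\<close> is at least \<open>1 / 2\<close>, so an item causes at most two basic
  insertions in expectation. Scanning a bucket costs \<open>O(d)\<close>, and the tower costs \<open>O(m)\<close>, which is
  \<open>O(d)\<close> for constant \<open>m\<close> because \<open>d \<ge> 1\<close>.
\<close>

section \<open>Deterministic running times\<close>


lemma snd_array_simps [simp]:
  "snd (tbind m f) = snd m + snd (f (fst m))" "snd (tret x) = 0" "snd (op x) = 1"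
  "snd (rd xs i) = 1" "snd (wr xs i y) = 1" "snd (len xs) = 1"
  "snd (push xs y) = 1" "snd (pop xs) = 1" "snd (clear xs) = 1"
  by (simp_all add: tbind_def tret_def op_def rd_def wr_def len_def push_def pop_def clear_def)

section \<open>Counting the entries on either side of a rank\<close>

lemma prefix_le_length_filter:
  assumes "i < length xs" and "\<And>j. j \<le> i \<Longrightarrow> Q (xs ! j)"
  shows "i < length (filter Q xs)"
proof -
  have "\<forall>x\<in>set (take (Suc i) xs). Q x"
    using assms by (auto simp: in_set_conv_nth)
  then have "length (filter Q (take (Suc i) xs)) = Suc i"
    using assms(1) by (simp add: filter_id_conv[THEN iffD2])
  moreover have "filter Q xs = filter Q (take (Suc i) xs) @ filter Q (drop (Suc i) xs)"
    by (metis append_take_drop_id filter_append)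
  ultimately show ?thesis
    by simp
qed

lemma suffix_le_length_filter:
  assumes "\<And>j. i \<le> j \<Longrightarrow> j < length xs \<Longrightarrow> Q (xs ! j)"
  shows "length xs - i \<le> length (filter Q xs)"
proof -
  have "\<forall>x\<in>set (drop i xs). Q x"
    using assms by (auto simp: in_set_conv_nth)
  then have "length (filter Q (drop i xs)) = length xs - i"
    by (simp add: filter_id_conv[THEN iffD2])
  moreover have "filter Q xs = filter Q (take i xs) @ filter Q (drop i xs)"
    by (metis append_take_drop_id filter_append)
  ultimately show ?thesis
    by simp
qed

lemma length_filter_sort: "length (filter Q (sort xs)) = length (filter Q xs)"
  by (metis mset_filter mset_sort size_mset)

text \<open>Sorting preserves how many entries satisfy \<open>Q\<close>, so a rank in the sorted
  list becomes a count in the original one.\<close>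

lemma rank_le_length_filter:
  assumes "i < length xs" and "\<And>x. x \<le> sort xs ! i \<Longrightarrow> Q x"
  shows "i < length (filter Q xs)"
  using prefix_le_length_filter[of i "sort xs" Q] assms
  by (simp add: length_filter_sort sorted_nth_mono)

lemma corank_le_length_filter:
  assumes "\<And>x. sort xs ! i \<le> x \<Longrightarrow> Q x"
  shows "length xs - i \<le> length (filter Q xs)"
  using suffix_le_length_filter[of i "sort xs" Q] assms
  by (simp add: length_filter_sort sorted_nth_mono)

text \<open>If the median of a group satisfies a downward closed \<open>Q\<close>, so do the two
  entries sorted before it; for an upward closed \<open>Q\<close>, the two after it. So each counted
  median stands for three counted entries of its group. Selection uses this for the entries on
  either side of the pivot.\<close>

lemma group_medians_count:
  assumes "(\<forall>x y. Q y \<longrightarrow> x \<le> y \<longrightarrow> Q x) \<or> (\<forall>x y. Q x \<longrightarrow> x \<le> y \<longrightarrow> Q y)"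
  shows "3 * length (filter Q (fst (group_medians xs ms)))
    \<le> length (filter Q xs) + 3 * length (filter Q ms)"
proof (induction xs ms rule: group_medians.induct)
  case (1 a b c d e xs ms)
  define g where "g = [a, b, c, d, e]"
  define m where "m = sort g ! 2"
  have g: "length g = 5"
    by (simp add: g_def)
  have m: "fst (insertion_sort [a, b, c, d, e]) ! 2 = m"
    unfolding m_def g_def by (simp only: insertion_sort_correct)
  have med: "3 \<le> length (filter Q g)" if "Q m"
    using assms
  proof
    assume "\<forall>x y. Q y \<longrightarrow> x \<le> y \<longrightarrow> Q x"
    then have "2 < length (filter Q g)"
      using that g by (intro rank_le_length_filter) (auto simp: m_def)
    then show ?thesis
      by simp
  next
    assume "\<forall>x y. Q x \<longrightarrow> x \<le> y \<longrightarrow> Q y"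
    then have "length g - 2 \<le> length (filter Q g)"
      using that by (intro corank_le_length_filter) (auto simp: m_def)
    then show ?thesis
      using g by simp
  qed
  have "fst (group_medians (a # b # c # d # e # xs) ms) = fst (group_medians xs (ms @ [m]))"
    using m by (simp del: insertion_sort.simps)
  then have "3 * length (filter Q (fst (group_medians (a # b # c # d # e # xs) ms)))
      \<le> length (filter Q xs) + 3 * length (filter Q (ms @ [m]))"
    using "1.IH"[OF refl refl refl] m by (simp del: insertion_sort.simps)
  also have "\<dots> \<le> length (filter Q (g @ xs)) + 3 * length (filter Q ms)"
    using med by (cases "Q m") simp_all
  finally show ?case
    by (simp add: g_def del: group_medians.simps)
qed auto

section \<open>Running time of selection\<close>

lemma sort_insert_time: "snd (sort_insert x ys) = 1 + 3 * length ys"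
  by (induction ys arbitrary: x) auto

lemma insertion_sort_length: "length (fst (insertion_sort xs)) = length xs"
  by (simp add: insertion_sort_correct)

text \<open>The exact cost \<open>1 + n + 3 * n * (n - 1) / 2\<close> for length \<open>n\<close>,
  doubled and rearranged to avoid division and subtraction of naturals.\<close>

lemma insertion_sort_time:
  "2 * snd (insertion_sort xs) + length xs = 2 + 3 * length xs * length xs"
  by (induction xs) (auto simp: sort_insert_time insertion_sort_length algebra_simps)

lemma group_medians_time: "5 * snd (group_medians xs ms) \<le> 38 * length xs + 5"
proof (induction xs ms rule: group_medians.induct)
  case (1 a b c d e xs ms)
  \<comment> \<open>With reading the median and pushing it, a group of five costs 38 steps.\<close>
  have "snd (insertion_sort [a, b, c, d, e]) = 36"
    using insertion_sort_time[of "[a, b, c, d, e]"] by (simp del: insertion_sort.simps)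
  then show ?case
    using "1.IH"[OF refl refl refl] by (simp del: insertion_sort.simps)
qed auto

lemma partition3_time: "snd (partition3 p xs ls n gs) \<le> 3 * length xs + 1"
proof (induction xs arbitrary: ls n gs)
  case (Cons x xs)
  have *: "snd (partition3 p xs ls' n' gs') \<le> 3 * length xs + 1" for ls' n' gs'
    by (rule Cons)
  show ?case
    using *[of "ls @ [x]" n gs] *[of ls "n+1" gs] *[of ls n "gs @ [x]"] by simp
qed simp

text \<open>With \<open>l = n div 5\<close> medians, both recursive calls have total length at most \<open>9 n / 10 + 6 / 5\<close>, and the
  remaining work is at most \<open>11 n\<close>; for \<open>n \<ge> 32\<close> the factor \<open>352 = 32 * 11\<close> closes the recursion.\<close>

lemma select_time: "snd (select k xs) \<le> 352 * (length xs + 1)"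
proof (induction "length xs" arbitrary: k xs rule: less_induct)
  case less
  show ?case
  proof (cases "length xs < 32")
    case True
    \<comment> \<open>Below the cutoff 32 the quadratic cost of sorting is bounded linearly.\<close>
    have "3 * length xs * length xs \<le> 96 * length xs"
      using True by simp
    moreover have "snd (select k xs) = 3 + snd (insertion_sort xs)"
      using True by (subst select.simps) simp
    moreover have "2 * snd (insertion_sort xs) + length xs = 2 + 3 * length xs * length xs"
      by (rule insertion_sort_time)
    ultimately show ?thesis
      unfolding distrib_left by linarith
  next
    case False
    define n where "n = length xs"
    define ms where "ms = fst (group_medians xs [])"
    define l where "l = length ms"
    define p where "p = fst (select ((l - 1) div 2) ms)"
    define ls es gs where "ls = filter (\<lambda>x. x < p) xs" and "es = filter (\<lambda>x. x = p) xs"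
      and "gs = filter (\<lambda>x. p < x) xs"
    have part: "fst (partition3 p xs [] 0 []) = (ls, length es, gs)"
      by (simp add: partition3_correct ls_def es_def gs_def)
    have l: "l = n div 5" "32 \<le> n"
      using False by (simp_all add: l_def ms_def n_def group_medians_length)
    have q: "(l - 1) div 2 < length ms"
      using l by (simp add: l_def)
    have p: "p = sort ms ! ((l - 1) div 2)"
      unfolding p_def by (intro select_correct q)
    have "(l - 1) div 2 < length (filter (\<lambda>x. x \<le> p) ms)"
      using q p by (intro rank_le_length_filter) auto
    then have low: "3 * ((l - 1) div 2 + 1) \<le> length (filter (\<lambda>x. x \<le> p) xs)"
      using group_medians_count[of "\<lambda>x. x \<le> p" xs "[]"]
      by (fastforce simp: ms_def)
    have "l - (l - 1) div 2 \<le> length (filter (\<lambda>x. p \<le> x) ms)"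
      unfolding l_def by (intro corank_le_length_filter) (simp add: p l_def)
    then have high: "3 * (l - (l - 1) div 2) \<le> length (filter (\<lambda>x. p \<le> x) xs)"
      using group_medians_count[of "\<lambda>x. p \<le> x" xs "[]"]
      by (fastforce simp: ms_def)
    \<comment> \<open>The pivot is the lower median of the medians, so at least half of them lie at
      or below it and at least half at or above it. The 4 accounts for the ignored trailing
      entries.\<close>
    have l_bounds: "l \<le> 2 * ((l - 1) div 2 + 1)" "l \<le> 2 * (l - (l - 1) div 2)" "n \<le> 5 * l + 4"
      using l by auto
    have "length gs + length (filter (\<lambda>x. x \<le> p) xs) = n"
      using sum_length_filter_compl[of "\<lambda>x. x \<le> p" xs] by (simp add: gs_def n_def not_le)
    \<comment> \<open>At least \<open>3 * l / 2\<close>, hence at least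
      \<open>3 * (n - 4) / 10\<close>, entries are excluded from \<open>gs\<close>; likewise for
      \<open>ls\<close> below.\<close>
    with low l_bounds have gs: "10 * length gs \<le> 7 * n + 12"
      by linarith
    have "length ls + length (filter (\<lambda>x. p \<le> x) xs) = n"
      using sum_length_filter_compl[of "\<lambda>x. p \<le> x" xs] by (simp add: ls_def n_def not_le)
    with high l_bounds have ls: "10 * length ls \<le> 7 * n + 12"
      by linarith
    define t where "t = (if k < length ls then snd (select k ls)
        else if k < length ls + length es then 0
        else snd (select (k - length ls - length es) gs))"
    have "snd (select k xs) \<le> 8 + snd (group_medians xs []) + snd (select ((l - 1) div 2) ms)
        + snd (partition3 p xs [] 0 []) + t"
      using False part
      by (subst select.simps) (simp add: p_def l_def ms_def t_def)
    moreover have "snd (select ((l - 1) div 2) ms) \<le> 352 * (l + 1)"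
      using less[of ms "(l - 1) div 2"] l by (simp add: l_def n_def)
    moreover have "length ls < length xs" "length gs < length xs"
      using ls gs l by (simp_all add: n_def)
    then have "t \<le> 352 * (length ls + 1) \<or> t \<le> 352 * (length gs + 1)"
      unfolding t_def using less[of ls k] less[of gs "k - length ls - length es"] by auto
    moreover have "5 * snd (group_medians xs []) \<le> 38 * n + 5"
      unfolding n_def by (rule group_medians_time)
    moreover have "snd (partition3 p xs [] 0 []) \<le> 3 * n + 1"
      unfolding n_def by (rule partition3_time)
    moreover have "5 * l \<le> n"
      using l by simp
    \<comment> \<open>The recursive calls cost at most \<open>352 * (9 * n / 10 + 16 / 5)\<close>.
      This leaves \<open>352 * (n / 10 - 11 / 5)\<close> up to the goal, which is at least
      \<open>11 * n\<close> exactly from \<open>n = 32\<close> on.\<close>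
    ultimately show ?thesis
      using ls gs l(2) unfolding n_def[symmetric] by auto
  qed
qed

section \<open>Scanning arrays and removing entries\<close>

lemma length_remove_at [simp]: "length (fst (remove_at xs i)) = length xs - 1"
  by (simp add: remove_at_def)

lemma remove_at_time [simp]: "snd (remove_at xs i) = 4"
  by (simp add: remove_at_def)

lemma scan_best_from_time: "snd (scan_best_from better y j xs i) = length xs + 1"
  by (induction xs arbitrary: y j i) auto

lemma scan_best_time: "snd (scan_best better xs) \<le> length xs + 2"
  by (simp add: scan_best_def scan_best_from_time)

lemma scan_first_from_time: "snd (scan_first_from Q xs i) \<le> length xs + 1"
  by (induction xs arbitrary: i) auto

lemma scan_first_time: "snd (scan_first Q xs) \<le> length xs + 1"
  unfolding scan_first_def by (rule scan_first_from_time)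

lemma scan_first_from_Some:
  "fst (scan_first_from Q xs i) = Some j \<Longrightarrow> i \<le> j \<and> j < i + length xs \<and> Q (xs ! (j - i))"
proof (induction xs arbitrary: i)
  case (Cons x xs)
  show ?case
  proof (cases "Q x")
    case True
    then show ?thesis
      using Cons.prems by simp
  next
    case False
    then have "Suc i \<le> j \<and> j < Suc i + length xs \<and> Q (xs ! (j - Suc i))"
      using Cons.prems by (intro Cons.IH) simp
    moreover from this have "j - i = Suc (j - Suc i)"
      by linarith
    ultimately show ?thesis
      by simp
  qed
qed simp

lemma scan_first_Some:
  "fst (scan_first Q xs) = Some j \<Longrightarrow> j < length xs \<and> Q (xs ! j)"
  using scan_first_from_Some[of Q xs 0 j] by (simp add: scan_first_def)

section \<open>Amortized cost of value fields\<close>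

definition field_ok :: "nat \<Rightarrow> nat \<Rightarrow> vfield \<Rightarrow> bool" where
  "field_ok r s F \<longleftrightarrow> length (cand F) < r \<and> length (rep F) \<le> s"

text \<open>The potential that each candidate holds: a flush costs at most \<open>1200 (r + s)\<close> steps and is
  preceded by \<open>r - 1 \<ge> r / 2\<close> insertions that did not flush.\<close>

definition credit :: "nat \<Rightarrow> nat \<Rightarrow> real" where
  "credit r s = 2400 * (1 + real s / real r)"

lemma credit_nonneg: "0 \<le> credit r s"
  by (simp add: credit_def)

lemma credit_pays_flush:
  assumes "2 \<le> r"
  shows "1200 * (real r + real s) \<le> credit r s * real (r - 1)"
proof -
  have "1200 * (real r + real s) = credit r s * (real r / 2)"
    using assms by (simp add: credit_def field_simps)
  also have "\<dots> \<le> credit r s * real (r - 1)"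
    using assms credit_nonneg by (intro mult_left_mono) (auto simp: of_nat_diff)
  finally show ?thesis .
qed

text \<open>Without a flush, four steps are made and one more candidate earns its credit. A flush
  empties the candidates, and the credit released pays for both selections and both scans.\<close>

lemma basic_insert_amortized:
  assumes "2 \<le> r" "field_ok r s F"
  shows "field_ok r s (fst (basic_insert r s x F))"
    and "real (snd (basic_insert r s x F)) + credit r s * length (cand (fst (basic_insert r s x F)))
      \<le> 4 + credit r s + credit r s * length (cand F)"
proof -
  let ?B = "basic_insert r s x F"
  have "field_ok r s (fst ?B) \<and> real (snd ?B) + credit r s * length (cand (fst ?B))
      \<le> 4 + credit r s + credit r s * length (cand F)"
  proof (cases "Suc (length (cand F)) = r")
    case False
    then show ?thesis
      using assms by (auto simp: basic_insert_def field_ok_def algebra_simps)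
  next
    case True
    define C where "C = cand F @ [x]"
    define R where "R = rep F @ [fst (select (r div 2 - 1) C), fst (select (r div 2) C)]"
    define i where "i = scan_best (\<lambda>a b. b < a) R"
    define R1 where "R1 = fst (remove_at R (fst i))"
    define j where "j = scan_best (\<lambda>a b. a < b) R1"
    define R2 where "R2 = fst (remove_at R1 (fst j))"
    have C: "length C = r"
      using True by (simp add: C_def)
    have R: "length R \<le> s + 2" "length R1 \<le> s + 1"
      using assms(2) by (simp_all add: R1_def R_def field_ok_def)
    have result: "fst ?B = VField [] (if s < length R then R2 else R)"
      using True by (simp add: basic_insert_def C_def R_def R1_def R2_def i_def j_def)
    have ok: "field_ok r s (fst ?B)"
      using assms R unfolding result field_ok_def by (auto simp: R1_def R2_def)
    have "snd ?B \<le> 10 + snd (select (r div 2 - 1) C) + snd (select (r div 2) C) + (8 + snd i + snd j)"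
      using True by (simp add: basic_insert_def C_def R_def R1_def i_def j_def)
    moreover have "snd (select (r div 2 - 1) C) \<le> 352 * (r + 1)" "snd (select (r div 2) C) \<le> 352 * (r + 1)"
      using select_time C by metis+
    moreover have "snd i \<le> s + 4" "snd j \<le> s + 3"
      using scan_best_time[of "\<lambda>a b. b < a" R] scan_best_time[of "\<lambda>a b. a < b" R1] R
      unfolding i_def j_def by linarith+
    \<comment> \<open>The sum is at most \<open>704 * r + 2 * s + 729\<close>, and
      \<open>r >= 2\<close> absorbs the constant.\<close>
    ultimately have "snd ?B \<le> 1200 * (r + s)"
      using assms(1) by simp
    then have "real (snd ?B) \<le> 1200 * (real r + real s)"
      by (metis of_nat_add of_nat_le_iff of_nat_mult of_nat_numeral)
    \<comment> \<open>A flush occurs only when exactly \<open>r - 1\<close> candidates were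
      stored.\<close>
    also have "\<dots> \<le> credit r s * real (length (cand F))"
      using credit_pays_flush[OF assms(1), of s] True by auto
    finally show ?thesis
      using ok credit_nonneg[of r s] by (simp add: result)
  qed
  then show "field_ok r s (fst ?B)"
    and "real (snd ?B) + credit r s * length (cand (fst ?B))
      \<le> 4 + credit r s + credit r s * length (cand F)"
    by blast+
qed

text \<open>The potential telescopes over the copies; the extra 1 pays for leaving the loop.\<close>

lemma insert_copies_amortized:
  assumes "2 \<le> r" "field_ok r s F"
  shows "field_ok r s (fst (insert_copies r s n x F)) \<and>
    real (snd (insert_copies r s n x F)) + credit r s * length (cand (fst (insert_copies r s n x F)))
      \<le> 1 + real n * (4 + credit r s) + credit r s * length (cand F)"
  using assms(2)
proof (induction n arbitrary: F)
  case (Suc n)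
  note B = basic_insert_amortized[OF assms(1) Suc.prems, of x]
  from Suc.IH[OF B(1)] B(2) show ?case
    by (simp add: algebra_simps)
qed simp

section \<open>Expected cost plus final potential\<close>

text \<open>Adding the final potential \<open>f\<close> to the cost makes sequential composition an equation
  (\<open>wcost_cbind\<close>), just as for weakest pre-expectations.\<close>

definition wcost :: "'a comp \<Rightarrow> ('a \<Rightarrow> ennreal) \<Rightarrow> ennreal" where
  "wcost m f = (\<integral>\<^sup>+ z. of_nat (snd z) + f (fst z) \<partial>measure_pmf (law m))"

lemma wcost_lift [simp]: "wcost (lift m) f = of_nat (snd m) + f (fst m)"
  by (simp add: wcost_def lift_def)

text \<open>A constant leaves the integral unscaled because the law has total mass 1.\<close>

lemma wcost_add_const: "wcost m (\<lambda>x. c + f x) = c + wcost m f"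
  by (simp add: wcost_def add.left_commute[of _ c] nn_integral_add
      measure_pmf.emeasure_space_1[simplified])

lemma wcost_cbind [simp]: "wcost (cbind m g) f = wcost m (\<lambda>x. wcost (g x) f)"
proof -
  \<comment> \<open>The steps of \<open>m\<close> are first charged to the final potential of
    \<open>g\<close>, then pulled out of it as a constant.\<close>
  have "wcost (cbind m g) f
      = (\<integral>\<^sup>+ z. wcost (g (fst z)) (\<lambda>y. of_nat (snd z) + f y) \<partial>measure_pmf (law m))"
    by (simp add: wcost_def cbind_def split_beta add_ac)
  also have "\<dots> = wcost m (\<lambda>x. wcost (g x) f)"
    by (simp only: wcost_add_const wcost_def[of m])
  finally show ?thesis .
qed

text \<open>Since \<open>p \<ge> 1 / 2\<close>, the expectation \<open>(1 - p) / p\<close> of the number of failures is at most \<open>1\<close>.\<close>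

lemma wcost_draw_geometric:
  assumes "1 / 2 \<le> p" "p \<le> 1" "0 \<le> a" "0 \<le> b"
    and "\<And>n. g (Suc n) \<le> ennreal (a + b * real n)"
  shows "wcost (draw_geometric p) g \<le> ennreal (a + b + 2)"
proof -
  let ?M = "measure_pmf (geometric_pmf p)"
  have p: "p \<in> {0<..1}"
    using assms by auto
  \<comment> \<open>With \<open>n\<close> failures, \<open>Suc n\<close> is both the value drawn and
    the number of coin flips paid.\<close>
  have "wcost (draw_geometric p) g = (\<integral>\<^sup>+ n. of_nat (Suc n) + g (Suc n) \<partial>?M)"
    by (simp add: wcost_def draw_geometric_def)
  also have "\<dots> \<le> (\<integral>\<^sup>+ n. ennreal (1 + a + (1 + b) * real n) \<partial>?M)"
  proof (rule nn_integral_mono)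
    fix n
    have "of_nat (Suc n) + g (Suc n) \<le> ennreal (real (Suc n)) + ennreal (a + b * real n)"
      unfolding ennreal_of_nat_eq_real_of_nat by (intro add_left_mono assms(5))
    also have "\<dots> = ennreal (1 + a + (1 + b) * real n)"
      using assms by (subst ennreal_plus[symmetric]) (auto simp: algebra_simps)
    finally show "of_nat (Suc n) + g (Suc n) \<le> ennreal (1 + a + (1 + b) * real n)" .
  qed
  also have "\<dots> = ennreal (\<integral> n. 1 + a + (1 + b) * real n \<partial>?M)"
    using assms integrable_real_geometric_pmf[OF p]
    by (intro nn_integral_eq_integral) auto
  also have "(\<integral> n. 1 + a + (1 + b) * real n \<partial>?M) = 1 + a + (1 + b) * ((1 - p) / p)"
    using integrable_real_geometric_pmf[OF p] expectation_geometric_pmf[OF p] by simp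
  also have "\<dots> \<le> a + b + 2"
  proof -
    have "(1 - p) / p \<le> 1"
      using assms(1,2) by (simp add: field_simps)
    then have "(1 + b) * ((1 - p) / p) \<le> (1 + b) * 1"
      using assms by (intro mult_left_mono) auto
    then show ?thesis
      by simp
  qed
  finally show ?thesis
    by (simp add: ennreal_leI)
qed

lemma of_nat_add_ennreal_le:
  "real n + x \<le> y \<Longrightarrow> 0 \<le> x \<Longrightarrow> of_nat n + ennreal x \<le> ennreal y"
  unfolding ennreal_of_nat_eq_real_of_nat
  using ennreal_leI[of "real n + x" y] by simp

text \<open>Moves the arithmetic from \<open>ennreal\<close> to the reals, where linear arithmetic
  applies. Since \<open>ennreal\<close> maps negative numbers to 0, additivity needs
  \<open>0 \<le> x\<close>.\<close>

lemma add_ennreal_le: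
  "X \<le> ennreal x \<Longrightarrow> real n + x \<le> y \<Longrightarrow> 0 \<le> x \<Longrightarrow> of_nat n + X \<le> ennreal y"
  by (meson add_left_mono of_nat_add_ennreal_le order_trans)

text \<open>In expectation there is at most one infinite copy besides \<open>v\<close>, hence two
  credits. The continuation \<open>g\<close> stands for the rest of the computation, and
  \<open>c\<close> bounds its costs and potential outside this field.\<close>

lemma field_insert_amortized:
  fixes P :: "'k sketch_params"
  defines "r \<equiv> cand_cap P" and "s \<equiv> rep_cap P"
  assumes P: "valid_params P" and F: "field_ok r s F" and c: "0 \<le> c"
    and g: "\<And>F'. field_ok r s F' \<Longrightarrow> g F' \<le> ennreal (c + credit r s * length (cand F'))"
  shows "wcost (field_insert P v F) g
    \<le> ennreal (c + credit r s * length (cand F) + 2 * credit r s + 11)"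
proof -
  let ?A = "credit r s"
  have r: "2 \<le> r"
    using P by (auto simp: valid_params_def r_def elim!: evenE)
  have A: "0 \<le> ?A"
    by (rule credit_nonneg)
  define w where "w = quantile P"
  have w: "0 < w" "w < 1"
    using P by (auto simp: valid_params_def w_def)
  have basic: "of_nat (snd (basic_insert r s y G)) + g (fst (basic_insert r s y G))
      \<le> ennreal (c + ?A * length (cand G) + ?A + 4)" if "field_ok r s G" for y G
  proof (rule add_ennreal_le)
    show "g (fst (basic_insert r s y G)) \<le> ennreal (c + ?A * length (cand (fst (basic_insert r s y G))))"
      by (intro g basic_insert_amortized r that)
  qed (use basic_insert_amortized(2)[OF r that, of y] c A in auto)
  \<comment> \<open>The 5 is 4 for inserting \<open>v\<close> and 1 for leaving the loop; each copy
    adds \<open>4 + ?A\<close>.\<close>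
  have "of_nat (snd (insert_copies r s n y F)) +
      (of_nat (snd (basic_insert r s (ereal v) (fst (insert_copies r s n y F)))) +
        g (fst (basic_insert r s (ereal v) (fst (insert_copies r s n y F)))))
      \<le> ennreal ((c + ?A * length (cand F) + ?A + 5) + (4 + ?A) * real n)" for n y
    using insert_copies_amortized[OF r F, of n y] c A
    by (intro add_ennreal_le[OF basic]) (auto simp: algebra_simps)
  then have geometric: "wcost (do {
        Z \<leftarrow> draw_geometric p;
        F' \<leftarrow> lift (insert_copies r s (Z - 1) y F);
        lift (basic_insert r s (ereal v) F')
      }) g \<le> ennreal ((c + ?A * length (cand F) + ?A + 5) + (4 + ?A) + 2)"
    if "1 / 2 \<le> p" "p \<le> 1" for p y
    unfolding wcost_cbind wcost_lift using c A that by (intro wcost_draw_geometric) auto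
  consider "1 / 2 < w" | "w < 1 / 2" | "w = 1 / 2"
    by linarith
  then show ?thesis
  proof cases
    \<comment> \<open>As \<open>w\<close> lies between 1/2 and 1, so does
      \<open>1 / (2 * w)\<close>. The next case follows the same pattern with \<open>1 - w\<close>
      for \<open>w\<close>.\<close>
    case 1
    then show ?thesis
      using geometric[of "1 / (2 * w)" \<infinity>] w
      by (simp add: field_insert_def Let_def w_def r_def s_def algebra_simps)
  next
    case 2
    then have "1 / 2 \<le> 1 / (2 - 2 * w)" "1 / (2 - 2 * w) \<le> 1"
      using w by (auto simp: field_simps)
    then show ?thesis
      using geometric[of "1 / (2 - 2 * w)" "-\<infinity>"] 2
      by (simp add: field_insert_def Let_def w_def r_def s_def algebra_simps)
  next
    case 3
    have "wcost (field_insert P v F) g \<le> ennreal (c + ?A * length (cand F) + ?A + 4)"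
      using basic[OF F] 3 by (simp add: field_insert_def Let_def w_def r_def s_def)
    also have "\<dots> \<le> ennreal (c + ?A * length (cand F) + 2 * ?A + 11)"
      using A by (intro ennreal_leI) simp
    finally show ?thesis .
  qed
qed


section \<open>Amortized cost of the sketch\<close>

definition cell_ok :: "nat \<Rightarrow> nat \<Rightarrow> 'k vcell option \<Rightarrow> bool" where
  "cell_ok r s c \<longleftrightarrow> (case c of None \<Rightarrow> True | Some c' \<Rightarrow> field_ok r s (cell_field c'))"

definition cell_load :: "'k vcell option \<Rightarrow> nat" where
  "cell_load c = (case c of None \<Rightarrow> 0 | Some c' \<Rightarrow> length (cand (cell_field c')))"

definition buckets_ok :: "'k sketch_params \<Rightarrow> 'k bucket list \<Rightarrow> bool" where
  "buckets_ok P Bs \<longleftrightarrow> length Bs = num_buckets P \<and>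
     (\<forall>B\<in>set Bs. length (cells B) = num_cells P \<and>
       (\<forall>c\<in>set (cells B). cell_ok (cand_cap P) (rep_cap P) c))"

text \<open>The potential of the whole sketch is \<open>credit\<close> times this number.\<close>

definition load :: "'k bucket list \<Rightarrow> nat" where
  "load Bs = (\<Sum>B\<leftarrow>Bs. \<Sum>c\<leftarrow>cells B. cell_load c)"

section \<open>Effect of bucket updates on load and invariant\<close>

lemma sum_list_map_update:
  fixes f :: "'a \<Rightarrow> nat"
  assumes "i < length xs"
  shows "sum_list (map f (xs[i := y])) + f (xs ! i) = sum_list (map f xs) + f y"
proof -
  have "f (xs ! i) \<le> sum_list (map f xs)"
    using assms by (intro member_le_sum_list) auto
  then show ?thesis
    using assms by (simp add: map_update sum_list_update)
qed

text \<open>Stated with a sum on each side, because subtraction of naturals truncates.\<close>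

lemma load_update_cell:
  assumes "i < length Bs" "j < length (cells (Bs ! i))"
  shows "load (Bs[i := Bucket vm ((cells (Bs ! i))[j := c])]) + cell_load (cells (Bs ! i) ! j)
    = load Bs + cell_load c"
  using sum_list_map_update[OF assms(2), of cell_load c]
    sum_list_map_update[OF assms(1), of "\<lambda>B. \<Sum>c\<leftarrow>cells B. cell_load c"
      "Bucket vm ((cells (Bs ! i))[j := c])"]
  by (simp add: load_def)

lemma load_update_votes:
  assumes "i < length Bs"
  shows "load (Bs[i := Bucket vm (cells (Bs ! i))]) = load Bs"
  using sum_list_map_update[OF assms, of "\<lambda>B. \<Sum>c\<leftarrow>cells B. cell_load c"
      "Bucket vm (cells (Bs ! i))"]
  by (simp add: load_def)

lemma buckets_ok_update:
  assumes "buckets_ok P Bs" "length cs = num_cells P"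
    and "\<forall>c\<in>set cs. cell_ok (cand_cap P) (rep_cap P) c"
  shows "buckets_ok P (Bs[i := Bucket vm cs])"
  using assms set_update_subset_insert[of Bs i "Bucket vm cs"] unfolding buckets_ok_def by fastforce

lemma buckets_okD:
  assumes "valid_params P" "buckets_ok P Bs"
  shows "bucket_hash P k < length Bs"
    and "length (cells (Bs ! bucket_hash P k)) = num_cells P"
    and "\<forall>c\<in>set (cells (Bs ! bucket_hash P k)). cell_ok (cand_cap P) (rep_cap P) c"
  using assms by (auto simp: buckets_ok_def valid_params_def)

lemma cell_load_le_load:
  assumes "i < length Bs" "j < length (cells (Bs ! i))"
  shows "cell_load (cells (Bs ! i) ! j) \<le> load Bs"
proof -
  have "cell_load (cells (Bs ! i) ! j) \<le> (\<Sum>c\<leftarrow>cells (Bs ! i). cell_load c)"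
    using assms(2) by (intro member_le_sum_list) auto
  also have "\<dots> \<le> load Bs"
    unfolding load_def using assms(1) by (intro member_le_sum_list) auto
  finally show ?thesis .
qed

text \<open>The common end of the three branches that store a value. \<open>F\<close> is either the
  old field of the cell or an empty one; in both cases it has no more candidates than the cell had,
  so starting from \<open>F\<close> can only release potential. Two array writes raise 11 to
  13.\<close>

lemma cell_update_amortized:
  fixes P :: "'k sketch_params"
  defines "A \<equiv> credit (cand_cap P) (rep_cap P)"
  assumes P: "valid_params P" and Bs: "buckets_ok P Bs" and c: "0 \<le> c"
    and i: "i = bucket_hash P k'" and j: "j < num_cells P"
    and F: "field_ok (cand_cap P) (rep_cap P) F"
      "length (cand F) \<le> cell_load (cells (Bs ! i) ! j)"
    and g: "\<And>Bs'. buckets_ok P Bs' \<Longrightarrow> g Bs' \<le> ennreal (c + A * load Bs')"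
  shows "wcost (do {
        F' \<leftarrow> field_insert P v F;
        cs \<leftarrow> lift (wr (cells (Bs ! i)) j (Some (VCell k vp F')));
        lift (wr Bs i (Bucket vm cs))
      }) g \<le> ennreal (c + A * load Bs + 2 * A + 13)"
proof -
  note ok = buckets_okD[OF P Bs, of k', folded i]
  let ?old = "cell_load (cells (Bs ! i) ! j)"
  have A: "0 \<le> A"
    by (simp add: A_def credit_nonneg)
  have old: "?old \<le> load Bs"
    using ok j by (intro cell_load_le_load) auto
  \<comment> \<open>The slack handed to the field insertion: the two writes and the potential of all
    other cells.\<close>
  define c' where "c' = c + 2 + A * (real (load Bs) - real ?old)"
  have slack: "0 \<le> A * (real (load Bs) - real ?old)"
    using A old by simp
  then have c': "0 \<le> c'"
    using c by (simp add: c'_def)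
  have "wcost (field_insert P v F)
      (\<lambda>F'. of_nat 2 + g (Bs[i := Bucket vm ((cells (Bs ! i))[j := Some (VCell k vp F')])]))
      \<le> ennreal (c' + A * length (cand F) + 2 * A + 11)"
    unfolding A_def
  proof (rule field_insert_amortized[OF P F(1) c'])
    fix F'
    assume F': "field_ok (cand_cap P) (rep_cap P) F'"
    let ?Bs = "Bs[i := Bucket vm ((cells (Bs ! i))[j := Some (VCell k vp F')])]"
    have "buckets_ok P ?Bs"
      using ok F' set_update_subset_insert[of "cells (Bs ! i)" j "Some (VCell k vp F')"]
      by (intro buckets_ok_update[OF Bs]) (auto simp: cell_ok_def)
    moreover have "load ?Bs + ?old = load Bs + length (cand F')"
      using load_update_cell[of i Bs j vm "Some (VCell k vp F')"] ok j by (simp add: cell_load_def)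
    then have "real (load ?Bs) = real (load Bs) - real ?old + length (cand F')"
      by linarith
    then have "A * load ?Bs = A * (real (load Bs) - real ?old) + A * length (cand F')"
      by (simp only: distrib_left)
    ultimately show "of_nat 2 + g ?Bs
        \<le> ennreal (c' + credit (cand_cap P) (rep_cap P) * length (cand F'))"
      unfolding A_def[symmetric] using A c slack by (intro add_ennreal_le[OF g]) (simp_all add: c'_def)
  qed
  also have "\<dots> \<le> ennreal (c + A * load Bs + 2 * A + 13)"
    using F(2) A by (intro ennreal_leI) (simp add: c'_def right_diff_distrib mult_left_mono)
  finally show ?thesis
    by (simp add: add.assoc[symmetric])
qed

text \<open>At most three scans of one bucket take \<open>3 * num_cells P + 4\<close> steps; at most
  8 further steps precede the common end, which adds 13.\<close>

lemma value_sketch_insert_amortized: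
  fixes P :: "'k sketch_params"
  defines "A \<equiv> credit (cand_cap P) (rep_cap P)"
  assumes P: "valid_params P" and Bs: "buckets_ok P Bs" and c: "0 \<le> c"
    and g: "\<And>Bs'. buckets_ok P Bs' \<Longrightarrow> g Bs' \<le> ennreal (c + A * load Bs')"
  shows "wcost (value_sketch_insert P k v Bs) g
    \<le> ennreal (c + A * load Bs + 2 * A + 3 * num_cells P + 30)"
proof -
  define i where "i = bucket_hash P k"
  define cs where "cs = cells (Bs ! i)"
  note ok = buckets_okD[OF P Bs, of k, folded i_def, folded cs_def]
  note update = cell_update_amortized[OF P Bs c i_def, folded cs_def A_def, OF _ _ _ g]
  have A: "0 \<le> A"
    by (simp add: A_def credit_nonneg)
  have empty: "field_ok (cand_cap P) (rep_cap P) (VField [] [])"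
    using P by (simp add: field_ok_def valid_params_def)
  define found where "found = scan_first (holds k) cs"
  define free where "free = scan_first Option.is_none cs"
  define best where "best = scan_best fewer_votes cs"
  have scans: "snd found \<le> num_cells P + 1" "snd free \<le> num_cells P + 1" "snd best \<le> num_cells P + 2"
    using scan_first_time[of "holds k" cs] scan_first_time[of Option.is_none cs]
      scan_best_time[of fewer_votes cs] ok by (simp_all add: found_def free_def best_def)
  show ?thesis
  proof (cases "fst found")
    case (Some j)
    then have j: "j < num_cells P" "holds k (cs ! j)"
      using scan_first_Some[of "holds k" cs j] ok by (auto simp: found_def)
    then obtain C where C: "cs ! j = Some C"
      by (auto simp: holds_def split: option.splits)
    then have "field_ok (cand_cap P) (rep_cap P) (cell_field C)"
      using ok j by (metis cell_ok_def nth_mem option.simps(5))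
    then have le: "wcost (do {
        F' \<leftarrow> field_insert P v (cell_field C);
        cs' \<leftarrow> lift (wr cs j (Some (VCell k (vote_plus C + 1) F')));
        lift (wr Bs i (Bucket (vote_minus (Bs ! i)) cs'))
      }) g \<le> ennreal (c + A * load Bs + 2 * A + 13)" (is "?X \<le> _")
      using j C by (intro update) (auto simp: cell_load_def)
    have eq: "wcost (value_sketch_insert P k v Bs) g = of_nat (4 + snd found) + ?X"
      using Some C by (simp add: value_sketch_insert_def i_def[symmetric] cs_def[symmetric]
          found_def[symmetric] add_ac)
    show ?thesis
      unfolding eq by (rule add_ennreal_le[OF le]) (use scans A c in simp_all)
  next
    case None
    note not_found = this
    show ?thesis
    proof (cases "fst free")
      case (Some j)
      then have j: "j < num_cells P"
        using scan_first_Some[of Option.is_none cs j] ok by (auto simp: free_def)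
      then have le: "wcost (do {
          F' \<leftarrow> field_insert P v (VField [] []);
          cs' \<leftarrow> lift (wr cs j (Some (VCell k 1 F')));
          lift (wr Bs i (Bucket (vote_minus (Bs ! i)) cs'))
        }) g \<le> ennreal (c + A * load Bs + 2 * A + 13)" (is "?X \<le> _")
        using empty by (intro update) auto
      have eq: "wcost (value_sketch_insert P k v Bs) g
          = of_nat (2 + snd found + snd free) + ?X"
        using Some not_found by (simp add: value_sketch_insert_def i_def[symmetric]
            cs_def[symmetric] found_def[symmetric] free_def[symmetric] add_ac)
      show ?thesis
        unfolding eq by (rule add_ennreal_le[OF le]) (use scans A c in simp_all)
    next
      case None
      define j where "j = fst best"
      define vm where "vm = vote_minus (Bs ! i) + 1"
      \<comment> \<open>\<open>scan_best\<close> returns a valid index only on a nonempty array,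
        which \<open>0 < num_cells P\<close> ensures.\<close>
      have "cs \<noteq> []"
        using ok P by (auto simp: valid_params_def)
      then have j: "j < num_cells P"
        using scan_best_correct(1)[of fewer_votes cs] ok
        by (auto simp: j_def best_def fewer_votes_def)
      show ?thesis
      proof (cases "evict_factor P * real (vote_plus (the (cs ! j))) \<le> real vm")
        case True
        \<comment> \<open>Clearing the evicted field yields \<open>VField [] []\<close>, so this is
          again an insertion into an empty field.\<close>
        have le: "wcost (do {
            F' \<leftarrow> field_insert P v (VField [] []);
            cs' \<leftarrow> lift (wr cs j (Some (VCell k 1 F')));
            lift (wr Bs i (Bucket 0 cs'))
          }) g \<le> ennreal (c + A * load Bs + 2 * A + 13)" (is "?X \<le> _")
          using empty j by (intro update) auto
        have eq: "wcost (value_sketch_insert P k v Bs) g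
            = of_nat (8 + snd found + snd free + snd best) + ?X"
          using True None not_found by (simp add: value_sketch_insert_def i_def[symmetric]
              cs_def[symmetric] found_def[symmetric] free_def[symmetric] best_def[symmetric]
              j_def[symmetric] vm_def clear_field_def add_ac)
        show ?thesis
          unfolding eq by (rule add_ennreal_le[OF le]) (use scans A c in simp_all)
      next
        case False
        have "buckets_ok P (Bs[i := Bucket vm cs])"
          using ok by (intro buckets_ok_update Bs) auto
        then have le: "g (Bs[i := Bucket vm cs]) \<le> ennreal (c + A * load Bs)"
          using g load_update_votes ok(1) unfolding cs_def by metis
        have eq: "wcost (value_sketch_insert P k v Bs) g
            = of_nat (6 + snd found + snd free + snd best) + g (Bs[i := Bucket vm cs])"
          using False None not_found by (simp add: value_sketch_insert_def i_def[symmetric]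
              cs_def[symmetric] found_def[symmetric] free_def[symmetric] best_def[symmetric]
              j_def[symmetric] vm_def add_ac)
        show ?thesis
          unfolding eq by (rule add_ennreal_le[OF le]) (use scans A c in simp_all)
      qed
    qed
  qed
qed

section \<open>The Tower Sketch and whole streams\<close>

lemma tower_min_time: "snd (tower_min P T k i) = 4 * i + 3"
  by (induction i) (simp_all add: tower_read_def)

lemma tower_increment_time: "snd (tower_increment P k i T) = 6 * i + 1"
  by (induction i) simp_all

text \<open>Ten steps per tower array cover a query (4) and an increment (6); 40 covers all constant
  terms.\<close>

definition item_cost :: "'k sketch_params \<Rightarrow> real" where
  "item_cost P = 2 * credit (cand_cap P) (rep_cap P)
    + 3 * num_cells P + 10 * tower_arrays P + 40"

lemma sketch_insert_amortized:
  fixes P :: "'k sketch_params"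
  defines "A \<equiv> credit (cand_cap P) (rep_cap P)"
  assumes P: "valid_params P" and S: "buckets_ok P (buckets S)" and c: "0 \<le> c"
    and g: "\<And>S'. buckets_ok P (buckets S') \<Longrightarrow> g S' \<le> ennreal (c + A * load (buckets S'))"
  shows "wcost (sketch_insert P e S) g \<le> ennreal (c + item_cost P + A * load (buckets S))"
proof -
  define q where "q = tower_query P (tower S) (fst e)"
  have A: "0 \<le> A"
    by (simp add: A_def credit_nonneg)
  \<comment> \<open>The query starts at row \<open>tower_arrays P - 1\<close>, so it takes
    \<open>4 * tower_arrays P - 1\<close> steps.\<close>
  have q: "snd q \<le> 4 * tower_arrays P"
    using P by (auto simp: q_def tower_query_def tower_min_time valid_params_def)
  have item: "item_cost P = 2 * A + 3 * num_cells P + 10 * tower_arrays P + 40"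
    by (simp add: item_cost_def A_def)
  show ?thesis
  proof (cases "fst q < threshold P")
    case True
    let ?ins = "tower_insert P (tower S) (fst e)"
    have "wcost (sketch_insert P e S) g
        = of_nat (2 + snd q + snd ?ins) + g (Sketch (fst ?ins) (buckets S))"
      using True by (simp add: sketch_insert_def q_def[symmetric] add_ac)
    also have "\<dots> \<le> ennreal (c + item_cost P + A * load (buckets S))"
      using q A c S
      by (intro add_ennreal_le[OF g])
        (auto simp: item tower_insert_def tower_increment_time)
    finally show ?thesis .
  next
    case False
    \<comment> \<open>The operation that rebuilds the sketch belongs to the continuation, so the
      slack is \<open>c + 1\<close>.\<close>
    have le: "wcost (value_sketch_insert P (fst e) (snd e) (buckets S))
          (\<lambda>Bs. of_nat 1 + g (Sketch (tower S) Bs))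
        \<le> ennreal (c + 1 + A * load (buckets S) + 2 * A + 3 * num_cells P + 30)"
      unfolding A_def
    proof (rule value_sketch_insert_amortized[OF P S])
      fix Bs
      assume "buckets_ok P Bs"
      then have le: "g (Sketch (tower S) Bs) \<le> ennreal (c + A * load Bs)"
        using g[of "Sketch (tower S) Bs"] by simp
      show "of_nat 1 + g (Sketch (tower S) Bs)
          \<le> ennreal (c + 1 + credit (cand_cap P) (rep_cap P) * load Bs)"
        unfolding A_def[symmetric] by (rule add_ennreal_le[OF le]) (use A c in simp_all)
    qed (use c in simp)
    have eq: "wcost (sketch_insert P e S) g = of_nat (1 + snd q)
        + wcost (value_sketch_insert P (fst e) (snd e) (buckets S))
          (\<lambda>Bs. of_nat 1 + g (Sketch (tower S) Bs))"
      using False by (simp add: sketch_insert_def q_def[symmetric] add_ac)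
    show ?thesis
      unfolding eq by (rule add_ennreal_le[OF le]) (use q A c in \<open>simp_all add: item\<close>)
  qed
qed

text \<open>In the induction the remaining stream is the continuation of the first item, and its
  bound without the potential term is the slack. The final potential is nonnegative and is
  dropped.\<close>

lemma process_stream_amortized:
  fixes P :: "'k sketch_params"
  assumes P: "valid_params P" and S: "buckets_ok P (buckets S)"
  shows "wcost (process_stream P es S) (\<lambda>_. 0)
    \<le> ennreal (length es * item_cost P + credit (cand_cap P) (rep_cap P) * load (buckets S))"
  using S
proof (induction es arbitrary: S)
  case (Cons e es)
  have "0 \<le> item_cost P"
    by (simp add: item_cost_def credit_nonneg)
  then have "wcost (sketch_insert P e S) (\<lambda>S'. wcost (process_stream P es S') (\<lambda>_. 0))
    \<le> ennreal (length es * item_cost P + item_cost P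
        + credit (cand_cap P) (rep_cap P) * load (buckets S))"
    using Cons.prems by (intro sketch_insert_amortized P Cons.IH) auto
  then show ?case
    by (simp add: algebra_simps)
qed simp

lemma initial_sketch_ok:
  "buckets_ok P (buckets (initial_sketch P))" "load (buckets (initial_sketch P)) = 0"
  by (auto simp: initial_sketch_def buckets_ok_def load_def cell_ok_def cell_load_def sum_list_replicate)

text \<open>All cells are empty initially, so no potential is owed at the start and the total
  divides evenly among the items.\<close>

lemma expected_amortized_time_le:
  assumes P: "valid_params P" and "es \<noteq> []"
  shows "expected_amortized_time P es \<le> ennreal (item_cost P)"
proof -
  let ?n = "real (length es)"
  let ?M = "law (process_stream P es (initial_sketch P))"
  have n: "0 < ?n"
    using assms by simp
  have "expected_amortized_time P es = (\<integral>\<^sup>+ z. of_nat (snd z) * ennreal (1 / ?n) \<partial>?M)"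
    unfolding expected_amortized_time_def
    by (intro nn_integral_cong)
      (auto simp: ennreal_of_nat_eq_real_of_nat simp flip: ennreal_mult)
  also have "\<dots> = wcost (process_stream P es (initial_sketch P)) (\<lambda>_. 0) * ennreal (1 / ?n)"
    by (simp add: wcost_def nn_integral_multc)
  also have "\<dots> \<le> ennreal (?n * item_cost P) * ennreal (1 / ?n)"
    using process_stream_amortized[OF P initial_sketch_ok(1), of es]
    by (intro mult_right_mono) (auto simp: initial_sketch_ok)
  also have "\<dots> = ennreal (item_cost P)"
    using n by (simp flip: ennreal_mult'')
  finally show ?thesis .
qed

theorem theorem7:
  fixes m :: nat
  shows "\<exists>K::real. K > 0 \<and>
    (\<forall>(P :: 'k sketch_params) (es :: ('k \<times> real) list).
       valid_params P \<and> tower_arrays P = m \<and> es \<noteq> [] \<longrightarrow>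
       expected_amortized_time P es
         \<le> ennreal (K * (real (rep_cap P) / real (cand_cap P) + real (num_cells P))))"
proof (intro exI conjI allI impI)
  \<comment> \<open>Two credits give 4800 both as a constant and as the coefficient of
    \<open>s / r\<close>. The constant \<open>4800 + 40 + 10 * m\<close> is absorbed by
    \<open>d >= 1\<close>, and the scans add 3 to the coefficient of \<open>d\<close>.\<close>
  show "0 < 4843 + 10 * real m"
    by simp
  fix P :: "'k sketch_params" and es :: "('k \<times> real) list"
  assume *: "valid_params P \<and> tower_arrays P = m \<and> es \<noteq> []"
  let ?x = "real (rep_cap P) / real (cand_cap P)" and ?d = "real (num_cells P)"
  have d: "1 \<le> ?d"
    using * by (simp add: valid_params_def Suc_le_eq)
  have "item_cost P = 4800 * ?x + 3 * ?d + (4840 + 10 * real m) * 1"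
    using * by (simp add: item_cost_def credit_def algebra_simps)
  also have "\<dots> \<le> 4800 * ?x + 3 * ?d + (4840 + 10 * real m) * ?d"
    using d by (intro add_left_mono mult_left_mono) auto
  also have "\<dots> = 4800 * ?x + (4843 + 10 * real m) * ?d"
    by (simp add: algebra_simps)
  also have "\<dots> \<le> (4843 + 10 * real m) * ?x + (4843 + 10 * real m) * ?d"
    by (intro add_right_mono mult_right_mono) auto
  finally have "item_cost P \<le> (4843 + 10 * real m) * (?x + ?d)"
    by (simp only: distrib_left)
  with * show "expected_amortized_time P es \<le> ennreal ((4843 + 10 * real m) * (?x + ?d))"
    using expected_amortized_time_le[of P es] by (meson ennreal_leI order_trans)
qed

end
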